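(* (The generalized infrafiltration theorem.) Let $F$ be a set and $\mathcal D$ an ultrafilter on $F$. Then every formula $\varphi$ of the language $L(\Sigma_2^g)$ of a generalized second-order signature $\Sigma_2^g$ is infrafiltrated with respect to $\mathcal D$; that is, for every collection $(\langle U_f,\gamma_f\rangle)_{f\in F}$ of evaluated systems of signature $\Sigma_2^g$ with true generalized equalities and belongings, $$\mathrm{Inf}_{\mathcal D}\prod_{f\in F}U_f\vDash\varphi\Big[\bowtie_{f\in F}\gamma_f\Big]\iff\{g\in F: U_g\vDash\varphi[\gamma_g]\}\in\mathcal D.$$
   Context: Types: $0$ is the first-order type; for $k\ge0$, $[\tau_0,\ldots,\tau_k]$ with all $\tau_\mu=0$ is a second-order type; for a set $A$, $0(A)=A$, $\check\tau(A)=A^{k+1}$, $\tau(A)=\mathcal P(A^{k+1})$. A generalized second-order signature $\Sigma_2^g$ has a set $\Theta$ of such types (containing $0$ and at least one second-order type), $\Theta_b$ its second-order types, constant symbols $\sigma^\tau_\omega$ ($\omega\in\Omega_\tau$), binary predicate symbols $\delta_\tau$ ($\tau\in\Theta$, generalized equality) and $\varepsilon_\tau$ ($\tau\in\Theta_b$, generalized belonging), and countably many variables of each type. Terms are constants and variables; atomic formulas are $q\,\delta_\tau\,r$ and $(q_0,\ldots,q_k)\,\varepsilon_\tau\,r$ ($\tau=[\tau_0,\ldots,\tau_k]$, $q_\mu$ of type $\tau_\mu$, $r$ of type $\tau$); formulas are built with $\lnot,\land,\lor,\Rightarrow,\exists x^\tau,\forall x^\tau$. A system $U=\langle A,S\rangle$: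 a set $A$, constants $s^\tau_\omega\in\tau(A)$, relations $\approx_\tau\subseteq\tau(A)^2$ containing identity, $\tilde\in_\tau\subseteq\check\tau(A)\times\tau(A)$ containing membership. An evaluation $\gamma$ assigns $\gamma(x^\tau)\in\tau(A)$; $U\vDash(q\delta_\tau r)[\gamma]$ iff $q[\gamma]\approx_\tau r[\gamma]$; $U\vDash((q_\mu)_\mu\varepsilon_\tau r)[\gamma]$ iff $(q_\mu[\gamma])_\mu\mathrel{\tilde\in_\tau}r[\gamma]$ (constants take value $s^\tau_\omega$, variables $\gamma(x)$); connectives as usual; $U\vDash(\exists x^\tau\psi)[\gamma]$ iff $U\vDash\psi[\gamma']$ for some $\gamma'$ agreeing with $\gamma$ off $x^\tau$; $\forall$ with "every". $U$ has true generalized equalities and belongings if each $\approx_\tau$ is an equivalence relation and, for $\tau=[\tau_0,\ldots,\tau_k]\in\Theta_b$, $x_\mu\approx_{\tau_\mu}y_\mu$ (all $\mu$) and $u\approx_\tau v$ imply $((x_\mu)_\mu\mathrel{\tilde\in_\tau}u\Leftrightarrow(y_\mu)_\mu\mathrel{\tilde\in_\tau}v)$. Infra-$\mathcal D$-product $\mathrm{Inf}_{\mathcal D}\prod_fU_f$ of $U_f=\langle A_f,S_f\rangle$ (with structures $s^\tau_{\omega f},\approx_{\tau,f},\tilde\in_{\tau,f}$): support $A=\prod_fA_f$; for $p\in A^{k+1}$, $p(f)\in A_f^{k+1}$ with $p(f)(\mu)=p(\mu)(f)$; for $P\subseteq A^{k+1}$, $P\langle f\rangle=\{p(f):p\in P\}$;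 constants $s^0_\omega(f)=s^0_{\omega f}$ and $s^\tau_\omega=\{p\in\check\tau(A):\forall f\ p(f)\in s^\tau_{\omega f}\}$ for second-order $\tau$; $p\approx_0q$ iff $\exists G\in\mathcal D\,\forall g\in G\ p(g)\approx_{0,g}q(g)$; $P\approx_\tau Q$ iff $\exists G\in\mathcal D\,\forall g\in G\ P\langle g\rangle\approx_{\tau,g}Q\langle g\rangle$; $p\mathrel{\tilde\in_\tau}P$ iff $\exists G\in\mathcal D\,\forall g\in G\ p(g)\mathrel{\tilde\in_{\tau,g}}P\langle g\rangle$. Crossing $\bowtie_f\gamma_f$: $\gamma(x)(f)=\gamma_f(x)$ for type-$0$ variables, $\gamma(x)=\{p\in\check\tau(A):\forall f\ p(f)\in\gamma_f(x)\}$ for variables of second-order type $\tau$. An ultrafilter on $F$ is a maximal proper filter (filter = family of subsets closed under finite intersections and supersets).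
   Formalization: Added hypothesis: for each second-order constant or free variable of φ, the set of f at which its value is empty is either empty or in D; otherwise the crossing may be empty while almost all factor values are not, and the equivalence fails, e.g. for y ε x. *)

theory Defs
  imports Main "HOL-Library.FuncSet" "HOL-Library.NList"
begin

text \<open>
  \<open>Fst\<close> is the type \<open>0\<close>; \<open>Snd k\<close> is the second-order type
  \<open>[0, ..., 0]\<close> with \<open>k + 1\<close> entries.
\<close>

datatype so_type = Fst | Snd nat

record 'w signature =
  sg_types :: "so_type set"
  sg_index :: "so_type \<Rightarrow> 'w set"

definition is_signature :: "'w signature \<Rightarrow> bool" where
  "is_signature \<Sigma> \<longleftrightarrow> Fst \<in> sg_types \<Sigma> \<and> (\<exists>k. Snd k \<in> sg_types \<Sigma>)"

datatype 'w so_term =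
    Const so_type 'w
  | Var so_type nat

datatype 'w so_form =
    Eq so_type "'w so_term" "'w so_term"
  | Bel nat "'w so_term list" "'w so_term"  \<comment> \<open>belonging predicate for the type \<open>Snd k\<close>\<close>
  | Neg "'w so_form"
  | Conj "'w so_form" "'w so_form"
  | Disj "'w so_form" "'w so_form"
  | Imp "'w so_form" "'w so_form"
  | Ex so_type nat "'w so_form"
  | All so_type nat "'w so_form"

fun term_of_type :: "'w signature \<Rightarrow> so_type \<Rightarrow> 'w so_term \<Rightarrow> bool" where
  "term_of_type \<Sigma> \<tau> (Const \<rho> w) \<longleftrightarrow> \<rho> = \<tau> \<and> \<tau> \<in> sg_types \<Sigma> \<and> w \<in> sg_index \<Sigma> \<tau>"
| "term_of_type \<Sigma> \<tau> (Var \<rho> n) \<longleftrightarrow> \<rho> = \<tau> \<and> \<tau> \<in> sg_types \<Sigma>"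

fun is_formula :: "'w signature \<Rightarrow> 'w so_form \<Rightarrow> bool" where
  "is_formula \<Sigma> (Eq \<tau> q r) \<longleftrightarrow> \<tau> \<in> sg_types \<Sigma> \<and> term_of_type \<Sigma> \<tau> q \<and> term_of_type \<Sigma> \<tau> r"
| "is_formula \<Sigma> (Bel k qs r) \<longleftrightarrow> Snd k \<in> sg_types \<Sigma> \<and> length qs = Suc k \<and>
     (\<forall>q\<in>set qs. term_of_type \<Sigma> Fst q) \<and> term_of_type \<Sigma> (Snd k) r"
| "is_formula \<Sigma> (Neg \<phi>) \<longleftrightarrow> is_formula \<Sigma> \<phi>"
| "is_formula \<Sigma> (Conj \<phi> \<psi>) \<longleftrightarrow> is_formula \<Sigma> \<phi> \<and> is_formula \<Sigma> \<psi>"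
| "is_formula \<Sigma> (Disj \<phi> \<psi>) \<longleftrightarrow> is_formula \<Sigma> \<phi> \<and> is_formula \<Sigma> \<psi>"
| "is_formula \<Sigma> (Imp \<phi> \<psi>) \<longleftrightarrow> is_formula \<Sigma> \<phi> \<and> is_formula \<Sigma> \<psi>"
| "is_formula \<Sigma> (Ex \<tau> n \<phi>) \<longleftrightarrow> \<tau> \<in> sg_types \<Sigma> \<and> is_formula \<Sigma> \<phi>"
| "is_formula \<Sigma> (All \<tau> n \<phi>) \<longleftrightarrow> \<tau> \<in> sg_types \<Sigma> \<and> is_formula \<Sigma> \<phi>"

text \<open>The free variables and the constants of a formula, collected as terms.\<close>

fun params :: "'w so_form \<Rightarrow> 'w so_term set" where
  "params (Eq \<tau> q r) = {q, r}"
| "params (Bel k qs r) = insert r (set qs)"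
| "params (Neg \<phi>) = params \<phi>"
| "params (Conj \<phi> \<psi>) = params \<phi> \<union> params \<psi>"
| "params (Disj \<phi> \<psi>) = params \<phi> \<union> params \<psi>"
| "params (Imp \<phi> \<psi>) = params \<phi> \<union> params \<psi>"
| "params (Ex \<tau> n \<phi>) = params \<phi> - {Var \<tau> n}"
| "params (All \<tau> n \<phi>) = params \<phi> - {Var \<tau> n}"

text \<open>
  Elements of \<open>A\<close> and subsets of \<open>A\<^sup>k\<^sup>+\<^sup>1\<close> live in one type, so that
  values of all types can be treated uniformly. Tuples in \<open>A\<^sup>k\<^sup>+\<^sup>1\<close>
  are lists of length \<open>k + 1\<close> over \<open>A\<close>; \<open>realm \<tau> A\<close> is the set
  \<open>\<tau>(A)\<close>.
\<close>

datatype 'a so_val = Elem (the_elem: 'a) | Rel (the_rel: "'a list set")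

fun realm :: "so_type \<Rightarrow> 'a set \<Rightarrow> 'a so_val set" where
  "realm Fst A = Elem ` A"
| "realm (Snd k) A = Rel ` Pow (nlists (Suc k) A)"

record ('a, 'w) system =
  support :: "'a set"
  const :: "so_type \<Rightarrow> 'w \<Rightarrow> 'a so_val"
  geq :: "so_type \<Rightarrow> ('a so_val \<times> 'a so_val) set"
  gbel :: "nat \<Rightarrow> ('a list \<times> 'a so_val) set"

definition is_system :: "'w signature \<Rightarrow> ('a, 'w) system \<Rightarrow> bool" where
  "is_system \<Sigma> U \<longleftrightarrow>
     (\<forall>\<tau>\<in>sg_types \<Sigma>. \<forall>w\<in>sg_index \<Sigma> \<tau>. const U \<tau> w \<in> realm \<tau> (support U)) \<and>
     (\<forall>\<tau>\<in>sg_types \<Sigma>. geq U \<tau> \<subseteq> realm \<tau> (support U) \<times> realm \<tau> (support U) \<and>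
        Id_on (realm \<tau> (support U)) \<subseteq> geq U \<tau>) \<and>
     (\<forall>k. Snd k \<in> sg_types \<Sigma> \<longrightarrow>
        gbel U k \<subseteq> nlists (Suc k) (support U) \<times> realm (Snd k) (support U) \<and>
        (\<forall>P\<subseteq>nlists (Suc k) (support U). \<forall>p\<in>P. (p, Rel P) \<in> gbel U k))"

definition true_geq_gbel :: "'w signature \<Rightarrow> ('a, 'w) system \<Rightarrow> bool" where
  "true_geq_gbel \<Sigma> U \<longleftrightarrow>
     (\<forall>\<tau>\<in>sg_types \<Sigma>. equiv (realm \<tau> (support U)) (geq U \<tau>)) \<and>
     (\<forall>k. Snd k \<in> sg_types \<Sigma> \<longrightarrow>
        (\<forall>x\<in>nlists (Suc k) (support U). \<forall>y\<in>nlists (Suc k) (support U).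
         \<forall>u\<in>realm (Snd k) (support U). \<forall>v\<in>realm (Snd k) (support U).
           (\<forall>\<mu>\<le>k. (Elem (x ! \<mu>), Elem (y ! \<mu>)) \<in> geq U Fst) \<and> (u, v) \<in> geq U (Snd k)
             \<longrightarrow> ((x, u) \<in> gbel U k \<longleftrightarrow> (y, v) \<in> gbel U k)))"

type_synonym 'a evaluation = "so_type \<times> nat \<Rightarrow> 'a so_val"

definition is_evaluation :: "'w signature \<Rightarrow> ('a, 'w) system \<Rightarrow> 'a evaluation \<Rightarrow> bool" where
  "is_evaluation \<Sigma> U \<gamma> \<longleftrightarrow> (\<forall>\<tau>\<in>sg_types \<Sigma>. \<forall>n. \<gamma> (\<tau>, n) \<in> realm \<tau> (support U))"

fun term_val :: "('a, 'w) system \<Rightarrow> 'a evaluation \<Rightarrow> 'w so_term \<Rightarrow> 'a so_val" where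
  "term_val U \<gamma> (Const \<tau> w) = const U \<tau> w"
| "term_val U \<gamma> (Var \<tau> n) = \<gamma> (\<tau>, n)"

fun sat :: "('a, 'w) system \<Rightarrow> 'a evaluation \<Rightarrow> 'w so_form \<Rightarrow> bool" where
  "sat U \<gamma> (Eq \<tau> q r) \<longleftrightarrow> (term_val U \<gamma> q, term_val U \<gamma> r) \<in> geq U \<tau>"
| "sat U \<gamma> (Bel k qs r) \<longleftrightarrow>
     (map (\<lambda>q. the_elem (term_val U \<gamma> q)) qs, term_val U \<gamma> r) \<in> gbel U k"
| "sat U \<gamma> (Neg \<phi>) \<longleftrightarrow> \<not> sat U \<gamma> \<phi>"
| "sat U \<gamma> (Conj \<phi> \<psi>) \<longleftrightarrow> sat U \<gamma> \<phi> \<and> sat U \<gamma> \<psi>"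
| "sat U \<gamma> (Disj \<phi> \<psi>) \<longleftrightarrow> sat U \<gamma> \<phi> \<or> sat U \<gamma> \<psi>"
| "sat U \<gamma> (Imp \<phi> \<psi>) \<longleftrightarrow> (sat U \<gamma> \<phi> \<longrightarrow> sat U \<gamma> \<psi>)"
| "sat U \<gamma> (Ex \<tau> n \<phi>) \<longleftrightarrow> (\<exists>v\<in>realm \<tau> (support U). sat U (\<gamma>((\<tau>, n) := v)) \<phi>)"
| "sat U \<gamma> (All \<tau> n \<phi>) \<longleftrightarrow> (\<forall>v\<in>realm \<tau> (support U). sat U (\<gamma>((\<tau>, n) := v)) \<phi>)"

text \<open>
  \<open>slice v f\<close> is \<open>p(f)\<close> for an element and
  \<open>P\<langle>f\<rangle>\<close> for a relation of the product.
\<close>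

definition tuple_at :: "('i \<Rightarrow> 'a) list \<Rightarrow> 'i \<Rightarrow> 'a list" where
  "tuple_at p f = map (\<lambda>q. q f) p"

fun slice :: "('i \<Rightarrow> 'a) so_val \<Rightarrow> 'i \<Rightarrow> 'a so_val" where
  "slice (Elem q) f = Elem (q f)"
| "slice (Rel P) f = Rel ((\<lambda>p. tuple_at p f) ` P)"

text \<open>
  The crossing of a family of values of the same type; it gives both the constants of the
  infraproduct and the crossing of evaluations.
\<close>

fun cross_val :: "'i set \<Rightarrow> ('i \<Rightarrow> 'a set) \<Rightarrow> so_type \<Rightarrow> ('i \<Rightarrow> 'a so_val) \<Rightarrow> ('i \<Rightarrow> 'a) so_val" where
  "cross_val F A Fst s = Elem (\<lambda>f\<in>F. the_elem (s f))"
| "cross_val F A (Snd k) s =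
     Rel {p \<in> nlists (Suc k) (\<Pi>\<^sub>E f\<in>F. A f). \<forall>f\<in>F. tuple_at p f \<in> the_rel (s f)}"

definition infra_prod ::
    "'i set \<Rightarrow> 'i set set \<Rightarrow> ('i \<Rightarrow> ('a, 'w) system) \<Rightarrow> ('i \<Rightarrow> 'a, 'w) system" where
  "infra_prod F D U = (let A = (\<Pi>\<^sub>E f\<in>F. support (U f)) in
     \<lparr> support = A,
       const = (\<lambda>\<tau> w. cross_val F (\<lambda>f. support (U f)) \<tau> (\<lambda>f. const (U f) \<tau> w)),
       geq = (\<lambda>\<tau>. {(u, v) \<in> realm \<tau> A \<times> realm \<tau> A.
                \<exists>G\<in>D. \<forall>g\<in>G. (slice u g, slice v g) \<in> geq (U g) \<tau>}),
       gbel = (\<lambda>k. {(p, u) \<in> nlists (Suc k) A \<times> realm (Snd k) A.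
                \<exists>G\<in>D. \<forall>g\<in>G. (tuple_at p g, slice u g) \<in> gbel (U g) k}) \<rparr>)"

definition crossing ::
    "'i set \<Rightarrow> ('i \<Rightarrow> ('a, 'w) system) \<Rightarrow> ('i \<Rightarrow> 'a evaluation) \<Rightarrow> ('i \<Rightarrow> 'a) evaluation" where
  "crossing F U \<gamma> = (\<lambda>(\<tau>, n). cross_val F (\<lambda>f. support (U f)) \<tau> (\<lambda>f. \<gamma> f (\<tau>, n)))"

text \<open>
  Filters are families of subsets of \<open>F\<close>; closure under finite intersections includes
  the empty intersection, so \<open>F\<close> itself belongs to every filter.
\<close>

definition filter_on :: "'i set \<Rightarrow> 'i set set \<Rightarrow> bool" where
  "filter_on F D \<longleftrightarrow> D \<subseteq> Pow F \<and> F \<in> D \<and> (\<forall>X\<in>D. \<forall>Y\<in>D. X \<inter> Y \<in> D) \<and>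
     (\<forall>X\<in>D. \<forall>Y. X \<subseteq> Y \<and> Y \<subseteq> F \<longrightarrow> Y \<in> D)"

definition proper_filter_on :: "'i set \<Rightarrow> 'i set set \<Rightarrow> bool" where
  "proper_filter_on F D \<longleftrightarrow> filter_on F D \<and> {} \<notin> D"

definition ultrafilter_on :: "'i set \<Rightarrow> 'i set set \<Rightarrow> bool" where
  "ultrafilter_on F D \<longleftrightarrow> proper_filter_on F D \<and>
     (\<forall>E. proper_filter_on F E \<and> D \<subseteq> E \<longrightarrow> E = D)"

text \<open>
  A crossing of relations is empty as soon as a single factor is empty, since
  \<open>\<forall>f \<in> F. p(f) \<in> \<gamma>\<^sub>f(x)\<close> is then unsatisfiable; a
  nonempty crossing \<open>P\<close> satisfies \<open>P\<langle>f\<rangle> = \<gamma>\<^sub>f(x)\<close>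
  for all \<open>f\<close>. So if \<open>\<gamma>\<^sub>f(x)\<close> is empty for some \<open>f\<close>
  but not for \<open>D\<close>-almost all \<open>f\<close>, the infraproduct cannot see the
  \<open>D\<close>-typical value, and the equivalence fails. Example: all systems have the support
  \<open>{0}\<close>, ordinary equality and ordinary membership; \<open>\<gamma>\<^sub>f(y) = 0\<close>;
  \<open>\<gamma>\<^sub>f(x) = {}\<close> for exactly one index \<open>f\<close>, whose singleton is not
  in \<open>D\<close>, and \<open>\<gamma>\<^sub>f(x) = {0}\<close> otherwise. Then
  \<open>y \<epsilon> x\<close> holds \<open>D\<close>-almost everywhere, but the crossing of
  \<open>x\<close> is empty and \<open>y \<epsilon> x\<close> fails in the infraproduct.
  The following condition excludes exactly this situation, and only for the second-order
  constants and free variables that occur in the formula (first-order values are never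
  \<open>Rel {}\<close>). It holds in particular if all these values are nonempty.
\<close>

definition no_sporadic_empty ::
    "'i set \<Rightarrow> 'i set set \<Rightarrow> ('i \<Rightarrow> ('a, 'w) system) \<Rightarrow> ('i \<Rightarrow> 'a evaluation) \<Rightarrow> 'w so_form \<Rightarrow> bool" where
  "no_sporadic_empty F D U \<gamma> \<phi> \<longleftrightarrow>
     (\<forall>t\<in>params \<phi>. let E = {f \<in> F. term_val (U f) (\<gamma> f) t = Rel {}} in E = {} \<or> E \<in> D)"

end

theory Submission
  imports Defs
begin

text \<open>
  The induction on formulas is run for a more flexible notion than crossing: an evaluation of the
  infraproduct together with a family of evaluations of the factors such that, for each free
  variable and constant of the formula, the slice of the value in the product is the value in
  the factor \<open>D\<close>-almost everywhere. This notion is kept under quantifiers because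
  every family of values of the factors is almost everywhere the family of slices of a value of
  the product: a family of relations that is almost everywhere empty is represented by the empty
  relation; otherwise its almost everywhere nonempty members may be completed to a family of
  nonempty relations, whose crossing has exactly these slices.
\<close>

section \<open>Ultrafilters and truth \<open>D\<close>-almost everywhere\<close>

locale ultrafilter =
  fixes F :: "'i set" and D :: "'i set set"
  assumes ultrafilter: "ultrafilter_on F D"
begin

text \<open>Truth on a set of \<open>D\<close>, read as a quantifier over indices. For an
  ultrafilter it commutes with every propositional connective, which settles those cases of the
  induction.\<close>

definition almost :: "('i \<Rightarrow> bool) \<Rightarrow> bool" where
  "almost P \<longleftrightarrow> {g \<in> F. P g} \<in> D"

lemma filter_on: "filter_on F D" and empty_notin: "{} \<notin> D"
  using ultrafilter by (auto simp: ultrafilter_on_def proper_filter_on_def)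

lemma sets_subset: "X \<in> D \<Longrightarrow> X \<subseteq> F"
  using filter_on by (auto simp: filter_on_def)

lemma space_mem: "F \<in> D"
  using filter_on by (simp add: filter_on_def)

lemma Int_mem: "X \<in> D \<Longrightarrow> Y \<in> D \<Longrightarrow> X \<inter> Y \<in> D"
  using filter_on by (simp add: filter_on_def)

lemma upward_closed: "X \<in> D \<Longrightarrow> X \<subseteq> Y \<Longrightarrow> Y \<subseteq> F \<Longrightarrow> Y \<in> D"
  using filter_on unfolding filter_on_def by meson

text \<open>If a member of \<open>D\<close> misses \<open>X\<close>, the complement of
  \<open>X\<close> includes it and so is in \<open>D\<close>. Otherwise adjoining \<open>X\<close>
  to \<open>D\<close> still gives a proper filter, and maximality puts \<open>X\<close> into
  \<open>D\<close>.\<close>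

lemma mem_or_compl_mem:
  assumes "X \<subseteq> F"
  shows "X \<in> D \<or> F - X \<in> D"
proof (cases "\<exists>Z\<in>D. Z \<inter> X = {}")
  case True
  then obtain Z where "Z \<in> D" "Z \<inter> X = {}" by blast
  then have "F - X \<in> D"
    using sets_subset by (blast intro: upward_closed)
  then show ?thesis ..
next
  case False
  \<comment> \<open>The filter generated by \<open>D\<close> and \<open>X\<close>; one
    \<open>Z\<close> is enough because \<open>D\<close> is closed under intersections.\<close>
  define E where "E = {Y. Y \<subseteq> F \<and> (\<exists>Z\<in>D. Z \<inter> X \<subseteq> Y)}"
  have "Y \<inter> Y' \<in> E" if Y: "Y \<in> E" "Y' \<in> E" for Y Y'
  proof -
    obtain Z Z' where Z: "Z \<in> D" "Z' \<in> D" "Z \<inter> X \<subseteq> Y" "Z' \<inter> X \<subseteq> Y'"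
      using Y by (auto simp: E_def)
    then have "Z \<inter> Z' \<in> D" "Z \<inter> Z' \<inter> X \<subseteq> Y \<inter> Y'"
      by (auto intro: Int_mem)
    then have "\<exists>Z\<in>D. Z \<inter> X \<subseteq> Y \<inter> Y'" by (rule bexI[rotated])
    moreover have "Y \<inter> Y' \<subseteq> F"
      using Y by (auto simp: E_def)
    ultimately show ?thesis
      by (simp add: E_def)
  qed
  moreover have "E \<subseteq> Pow F" "F \<in> E" "\<forall>Y\<in>E. \<forall>Y'. Y \<subseteq> Y' \<and> Y' \<subseteq> F \<longrightarrow> Y' \<in> E"
    using assms space_mem unfolding E_def by blast+
  ultimately have "filter_on F E"
    by (auto simp: filter_on_def)
  moreover have "{} \<notin> E"
    using False by (auto simp: E_def)
  moreover have "D \<subseteq> E"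
    using sets_subset by (auto simp: E_def)
  ultimately have "E = D"
    using ultrafilter by (simp add: ultrafilter_on_def proper_filter_on_def)
  moreover have "X \<in> E"
    using assms space_mem by (auto simp: E_def)
  ultimately show ?thesis by simp
qed

lemma almostI: "(\<And>g. g \<in> F \<Longrightarrow> P g) \<Longrightarrow> almost P"
  unfolding almost_def by (rule upward_closed[OF space_mem]) auto

lemma almost_mono: "almost P \<Longrightarrow> (\<And>g. g \<in> F \<Longrightarrow> P g \<Longrightarrow> Q g) \<Longrightarrow> almost Q"
  unfolding almost_def by (erule upward_closed) auto

lemma almost_conj: "almost (\<lambda>g. P g \<and> Q g) \<longleftrightarrow> almost P \<and> almost Q"
proof
  assume "almost P \<and> almost Q"
  then have "{g \<in> F. P g} \<inter> {g \<in> F. Q g} \<in> D"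
    unfolding almost_def by (blast intro: Int_mem)
  then show "almost (\<lambda>g. P g \<and> Q g)"
    unfolding almost_def by (rule upward_closed) auto
qed (auto elim: almost_mono)

text \<open>Left to right is properness: two complementary sets in \<open>D\<close> would meet in
  the empty set. Right to left is maximality, through \<open>mem_or_compl_mem\<close>.\<close>

lemma almost_not: "almost (\<lambda>g. \<not> P g) \<longleftrightarrow> \<not> almost P"
proof
  assume "almost (\<lambda>g. \<not> P g)"
  show "\<not> almost P"
  proof
    assume "almost P"
    with \<open>almost (\<lambda>g. \<not> P g)\<close> have "almost (\<lambda>g. P g \<and> \<not> P g)"
      by (simp only: almost_conj)
    then show False
      using empty_notin by (simp add: almost_def)
  qed
next
  assume "\<not> almost P"
  then have "F - {g \<in> F. P g} \<in> D"
    using mem_or_compl_mem[of "{g \<in> F. P g}"] by (auto simp: almost_def)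
  also have "F - {g \<in> F. P g} = {g \<in> F. \<not> P g}" by auto
  finally show "almost (\<lambda>g. \<not> P g)" by (simp add: almost_def)
qed

lemma almost_disj: "almost (\<lambda>g. P g \<or> Q g) \<longleftrightarrow> almost P \<or> almost Q"
  using almost_not[of "\<lambda>g. \<not> P g \<and> \<not> Q g"] by (simp add: almost_conj almost_not)

lemma almost_imp: "almost (\<lambda>g. P g \<longrightarrow> Q g) \<longleftrightarrow> (almost P \<longrightarrow> almost Q)"
  by (simp only: imp_conv_disj almost_disj almost_not)

lemma almost_cong:
  assumes "almost R" "\<And>g. g \<in> F \<Longrightarrow> R g \<Longrightarrow> P g \<longleftrightarrow> Q g"
  shows "almost P \<longleftrightarrow> almost Q"
proof -
  have "almost (\<lambda>g. P g \<longrightarrow> Q g)" "almost (\<lambda>g. Q g \<longrightarrow> P g)"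
    using assms(2) by (auto intro: almost_mono[OF assms(1)])
  then show ?thesis by (auto simp: almost_imp)
qed

lemma almost_ball_finite:
  "finite T \<Longrightarrow> \<forall>t\<in>T. almost (P t) \<Longrightarrow> almost (\<lambda>g. \<forall>t\<in>T. P t g)"
  by (induction T rule: finite_induct) (auto simp: almost_conj intro: almostI)

text \<open>Links \<open>almost\<close> to the relations of the infraproduct, which are defined
  through some \<open>G\<close> in \<open>D\<close>; upward closure passes from \<open>G\<close> to
  the full truth set.\<close>

lemma almost_iff_ex_mem: "almost P \<longleftrightarrow> (\<exists>G\<in>D. \<forall>g\<in>G. P g)"
proof
  assume "\<exists>G\<in>D. \<forall>g\<in>G. P g"
  then obtain G where "G \<in> D" "\<forall>g\<in>G. P g" by blast
  then show "almost P"
    unfolding almost_def using sets_subset by (blast intro: upward_closed)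
qed (auto simp: almost_def intro!: bexI[of _ "{g \<in> F. P g}"])

end

section \<open>Slices and crossings of values\<close>

lemma tuple_at_mem_nlists:
  "p \<in> nlists n (\<Pi>\<^sub>E f\<in>F. A f) \<Longrightarrow> g \<in> F \<Longrightarrow> tuple_at p g \<in> nlists n (A g)"
  unfolding nlists_def tuple_at_def subset_eq by (simp add: PiE_iff)

lemma slice_mem_realm:
  assumes "v \<in> realm \<tau> (\<Pi>\<^sub>E f\<in>F. A f)" "g \<in> F"
  shows "slice v g \<in> realm \<tau> (A g)"
proof (cases \<tau>)
  case Fst
  then show ?thesis using assms by auto
next
  case (Snd k)
  then obtain P where "v = Rel P" "P \<subseteq> nlists (Suc k) (\<Pi>\<^sub>E f\<in>F. A f)"
    using assms(1) by auto
  then have "(\<lambda>p. tuple_at p g) ` P \<subseteq> nlists (Suc k) (A g)"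
    using tuple_at_mem_nlists[of _ "Suc k" F A g] assms(2) by blast
  then show ?thesis
    using Snd \<open>v = Rel P\<close> by simp
qed

text \<open>Transposition: a family of tuples is read as a tuple of functions. Restricting the
  components to \<open>F\<close> makes them extensional, as the product demands.\<close>

lemma ex_tuple_at:
  assumes y: "\<And>f. f \<in> F \<Longrightarrow> y f \<in> nlists n (A f)"
  obtains p where "p \<in> nlists n (\<Pi>\<^sub>E f\<in>F. A f)" "\<And>f. f \<in> F \<Longrightarrow> tuple_at p f = y f"
proof
  let ?p = "map (\<lambda>i. \<lambda>f\<in>F. y f ! i) [0..<n]"
  show "tuple_at ?p f = y f" if "f \<in> F" for f
  proof (rule nth_equalityI)
    show "length (tuple_at ?p f) = length (y f)"
      using nlistsE_length[OF y[OF that]] by (simp add: tuple_at_def)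
  qed (use that in \<open>simp add: tuple_at_def\<close>)
  have "y f ! i \<in> A f" if "f \<in> F" "i < n" for f i
    using nlistsE_nth_in[OF y[OF that(1)] that(2)] .
  then have "set ?p \<subseteq> (\<Pi>\<^sub>E f\<in>F. A f)"
    by auto
  then show "?p \<in> nlists n (\<Pi>\<^sub>E f\<in>F. A f)"
    by (intro nlistsI) simp_all
qed

lemma cross_val_mem_realm:
  "(\<And>f. f \<in> F \<Longrightarrow> s f \<in> realm \<tau> (A f)) \<Longrightarrow> cross_val F A \<tau> s \<in> realm \<tau> (\<Pi>\<^sub>E f\<in>F. A f)"
  by (cases \<tau>) fastforce+

text \<open>For relations, only the inclusion of \<open>s g\<close> in the slice needs care: a tuple
  at \<open>g\<close> must extend to one whose value at every other index lies in that factor's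
  relation, and nonemptiness supplies those values.\<close>

lemma slice_cross_val:
  assumes s: "\<And>f. f \<in> F \<Longrightarrow> s f \<in> realm \<tau> (A f)"
    and nonempty: "\<And>f. f \<in> F \<Longrightarrow> s f \<noteq> Rel {}"
    and "g \<in> F"
  shows "slice (cross_val F A \<tau> s) g = s g"
proof (cases \<tau>)
  case Fst
  then show ?thesis using s[OF \<open>g \<in> F\<close>] \<open>g \<in> F\<close> by auto
next
  case (Snd k)
  define R where "R f = the_rel (s f)" for f
  have sR: "s f = Rel (R f)" "R f \<subseteq> nlists (Suc k) (A f)" "R f \<noteq> {}" if "f \<in> F" for f
    using s[OF that] nonempty[OF that] Snd by (auto simp: R_def)
  have "x \<in> (\<lambda>p. tuple_at p g) ` {p \<in> nlists (Suc k) (\<Pi>\<^sub>E f\<in>F. A f). \<forall>f\<in>F. tuple_at p f \<in> R f}"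
    if x: "x \<in> R g" for x
  proof -
    \<comment> \<open>The prescribed tuple at \<open>g\<close>, an arbitrary tuple of the relation
      elsewhere.\<close>
    define y where "y f = (if f = g then x else SOME z. z \<in> R f)" for f
    have y: "y f \<in> R f" if "f \<in> F" for f
      using x sR(3)[OF that] by (auto simp: y_def some_in_eq)
    then obtain p where "p \<in> nlists (Suc k) (\<Pi>\<^sub>E f\<in>F. A f)" "\<And>f. f \<in> F \<Longrightarrow> tuple_at p f = y f"
      using ex_tuple_at[of F y "Suc k" A] sR(2) by blast
    then show ?thesis
      using y \<open>g \<in> F\<close> by (auto simp: y_def intro!: image_eqI[of _ _ p])
  qed
  then have "(\<lambda>p. tuple_at p g) ` {p \<in> nlists (Suc k) (\<Pi>\<^sub>E f\<in>F. A f). \<forall>f\<in>F. tuple_at p f \<in> R f} = R g"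
    using \<open>g \<in> F\<close> by auto
  then show ?thesis
    using Snd sR(1)[OF \<open>g \<in> F\<close>] by (simp add: R_def[symmetric])
qed

text \<open>Supplies default values: an element for \<open>Fst\<close>, the singleton of a constant
  tuple for \<open>Snd k\<close>.\<close>

lemma ex_nonempty_in_realm:
  assumes "A \<noteq> {}"
  obtains v where "v \<in> realm \<tau> A" "v \<noteq> Rel {}"
proof (cases \<tau>)
  case Fst
  then show ?thesis using assms that by auto
next
  case (Snd k)
  obtain a where "a \<in> A" using assms by auto
  then have "Rel {replicate (Suc k) a} \<in> realm \<tau> A"
    using Snd by (auto simp del: replicate_Suc intro!: imageI nlists_replicateI)
  then show ?thesis using that by blast
qed

text \<open>One empty factor makes the condition defining the crossing unsatisfiable. The type
  \<open>Fst\<close> cannot occur, since its values are never relations.\<close>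

lemma slice_cross_val_Rel_empty:
  assumes "g \<in> F" "s g = Rel {}" "s g \<in> realm \<tau> (A g)" "h \<in> F"
  shows "slice (cross_val F A \<tau> s) h = Rel {}"
  using assms by (cases \<tau>) force+

section \<open>Representing families of values in the product, and quantifiers over realms\<close>

context ultrafilter
begin

text \<open>With no empty factor the slices are exact everywhere. With an empty factor the crossing
  is empty, hence right exactly on the set of empty factors, which is then in
  \<open>D\<close>.\<close>

lemma almost_slice_cross_val:
  assumes "\<And>f. f \<in> F \<Longrightarrow> s f \<in> realm \<tau> (A f)"
    and "let E = {f \<in> F. s f = Rel {}} in E = {} \<or> E \<in> D"
  shows "almost (\<lambda>g. slice (cross_val F A \<tau> s) g = s g)"
proof (cases "{f \<in> F. s f = Rel {}} = {}")
  case True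
  with assms(1) show ?thesis
    by (intro almostI slice_cross_val) auto
next
  case False
  then obtain h where h: "h \<in> F" "s h = Rel {}" by blast
  from False assms(2) have "almost (\<lambda>f. s f = Rel {})"
    by (simp only: almost_def Let_def simp_thms)
  then show ?thesis
    by (rule almost_mono) (use h assms(1) in \<open>metis slice_cross_val_Rel_empty\<close>)
qed

lemma ex_almost_slice:
  assumes s: "\<And>f. f \<in> F \<Longrightarrow> s f \<in> realm \<tau> (A f)" and A: "\<And>f. f \<in> F \<Longrightarrow> A f \<noteq> {}"
  obtains v where "v \<in> realm \<tau> (\<Pi>\<^sub>E f\<in>F. A f)" "almost (\<lambda>g. slice v g = s g)"
proof (cases "almost (\<lambda>f. s f = Rel {})")
  case True
  \<comment> \<open>Members of \<open>D\<close> are nonempty, so some factor is empty and the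
    crossing of \<open>s\<close> is the empty relation.\<close>
  with s have "almost (\<lambda>g. slice (cross_val F A \<tau> s) g = s g)"
    by (intro almost_slice_cross_val) (auto simp: almost_def Let_def)
  then show ?thesis
    using that cross_val_mem_realm[of F s \<tau> A] s by blast
next
  case False
  \<comment> \<open>Replaces the empty relations by nonempty defaults. By \<open>almost_not\<close>
    this changes nothing almost everywhere.\<close>
  define s' where "s' f = (if s f = Rel {} then SOME v. v \<in> realm \<tau> (A f) \<and> v \<noteq> Rel {} else s f)" for f
  have s': "s' f \<in> realm \<tau> (A f)" "s' f \<noteq> Rel {}" if "f \<in> F" for f
  proof -
    have "\<exists>v. v \<in> realm \<tau> (A f) \<and> v \<noteq> Rel {}"
      using ex_nonempty_in_realm[OF A[OF that]] by metis
    from someI_ex[OF this] show "s' f \<in> realm \<tau> (A f)" "s' f \<noteq> Rel {}"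
      using s[OF that] by (auto simp: s'_def)
  qed
  have "almost (\<lambda>f. s f \<noteq> Rel {})"
    using False by (simp add: almost_not)
  then have "almost (\<lambda>g. slice (cross_val F A \<tau> s') g = s g)"
    by (rule almost_mono) (subst slice_cross_val, auto simp: s' , simp add: s'_def)
  then show ?thesis
    using that cross_val_mem_realm[of F s' \<tau> A] s' by blast
qed

text \<open>The quantifier step. A value of the product yields witnesses by slicing; conversely,
  witnesses chosen in the factors are glued by \<open>ex_almost_slice\<close>.\<close>

lemma almost_bex_realm:
  assumes "\<And>f. f \<in> F \<Longrightarrow> A f \<noteq> {}"
  shows "(\<exists>v\<in>realm \<tau> (\<Pi>\<^sub>E f\<in>F. A f). almost (\<lambda>g. Q g (slice v g))) \<longleftrightarrow>
    almost (\<lambda>g. \<exists>x\<in>realm \<tau> (A g). Q g x)"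
proof
  assume "\<exists>v\<in>realm \<tau> (\<Pi>\<^sub>E f\<in>F. A f). almost (\<lambda>g. Q g (slice v g))"
  then show "almost (\<lambda>g. \<exists>x\<in>realm \<tau> (A g). Q g x)"
    by (auto elim!: almost_mono intro: slice_mem_realm)
next
  assume ex: "almost (\<lambda>g. \<exists>x\<in>realm \<tau> (A g). Q g x)"
  \<comment> \<open>The implication keeps \<open>s g\<close> in the realm also where no witness
    exists, as gluing needs a legitimate value at every index.\<close>
  define s where "s g = (SOME x. x \<in> realm \<tau> (A g) \<and> ((\<exists>x\<in>realm \<tau> (A g). Q g x) \<longrightarrow> Q g x))" for g
  have s: "s g \<in> realm \<tau> (A g) \<and> ((\<exists>x\<in>realm \<tau> (A g). Q g x) \<longrightarrow> Q g (s g))" if "g \<in> F" for g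
    unfolding s_def
  proof (rule someI_ex)
    show "\<exists>x. x \<in> realm \<tau> (A g) \<and> ((\<exists>x\<in>realm \<tau> (A g). Q g x) \<longrightarrow> Q g x)"
      using ex_nonempty_in_realm[OF assms[OF that]] by metis
  qed
  then obtain v where v: "v \<in> realm \<tau> (\<Pi>\<^sub>E f\<in>F. A f)" "almost (\<lambda>g. slice v g = s g)"
    using ex_almost_slice[of s \<tau> A] assms by blast
  from ex v(2) have "almost (\<lambda>g. (\<exists>x\<in>realm \<tau> (A g). Q g x) \<and> slice v g = s g)"
    by (simp add: almost_conj)
  then have "almost (\<lambda>g. Q g (slice v g))"
    by (rule almost_mono) (use s in auto)
  with v(1) show "\<exists>v\<in>realm \<tau> (\<Pi>\<^sub>E f\<in>F. A f). almost (\<lambda>g. Q g (slice v g))" ..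
qed

text \<open>Dual of the existential case: apply it to the negation of \<open>Q\<close> and use
  \<open>almost_not\<close>.\<close>

lemma almost_ball_realm:
  assumes "\<And>f. f \<in> F \<Longrightarrow> A f \<noteq> {}"
  shows "(\<forall>v\<in>realm \<tau> (\<Pi>\<^sub>E f\<in>F. A f). almost (\<lambda>g. Q g (slice v g))) \<longleftrightarrow>
    almost (\<lambda>g. \<forall>x\<in>realm \<tau> (A g). Q g x)"
  using almost_bex_realm[of A \<tau> "\<lambda>g x. \<not> Q g x", OF assms]
    almost_not[of "\<lambda>g. \<forall>x\<in>realm \<tau> (A g). Q g x"]
  by (simp add: almost_not) blast

end

section \<open>Terms and satisfaction in the infraproduct\<close>

lemma support_infra_prod [simp]: "support (infra_prod F D U) = (\<Pi>\<^sub>E f\<in>F. support (U f))"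
  by (simp add: infra_prod_def Let_def)

lemma const_infra_prod [simp]:
  "const (infra_prod F D U) \<tau> w = cross_val F (\<lambda>f. support (U f)) \<tau> (\<lambda>f. const (U f) \<tau> w)"
  by (simp add: infra_prod_def Let_def)

context ultrafilter
begin

lemma geq_infra_prod:
  "(u, v) \<in> geq (infra_prod F D U) \<tau> \<longleftrightarrow>
    u \<in> realm \<tau> (\<Pi>\<^sub>E f\<in>F. support (U f)) \<and> v \<in> realm \<tau> (\<Pi>\<^sub>E f\<in>F. support (U f)) \<and>
    almost (\<lambda>g. (slice u g, slice v g) \<in> geq (U g) \<tau>)"
  by (simp add: infra_prod_def Let_def almost_iff_ex_mem)

lemma gbel_infra_prod:
  "(p, u) \<in> gbel (infra_prod F D U) k \<longleftrightarrow>
    p \<in> nlists (Suc k) (\<Pi>\<^sub>E f\<in>F. support (U f)) \<and> u \<in> realm (Snd k) (\<Pi>\<^sub>E f\<in>F. support (U f)) \<and>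
    almost (\<lambda>g. (tuple_at p g, slice u g) \<in> gbel (U g) k)"
  by (simp add: infra_prod_def Let_def almost_iff_ex_mem)

end

lemma term_val_mem_realm:
  assumes "is_system \<Sigma> U" "is_evaluation \<Sigma> U \<gamma>" "term_of_type \<Sigma> \<tau> t"
  shows "term_val U \<gamma> t \<in> realm \<tau> (support U)"
  using assms by (cases t) (auto simp: is_system_def is_evaluation_def)

lemma term_val_infra_prod_mem_realm:
  assumes "\<And>f. f \<in> F \<Longrightarrow> is_system \<Sigma> (U f)" "is_evaluation \<Sigma> (infra_prod F D U) \<delta>"
    and "term_of_type \<Sigma> \<tau> t"
  shows "term_val (infra_prod F D U) \<delta> t \<in> realm \<tau> (\<Pi>\<^sub>E f\<in>F. support (U f))"
  using assms
  by (cases t) (auto simp: is_system_def is_evaluation_def intro: cross_val_mem_realm)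

lemma is_evaluation_upd:
  "is_evaluation \<Sigma> U \<gamma> \<Longrightarrow> v \<in> realm \<tau> (support U) \<Longrightarrow> is_evaluation \<Sigma> U (\<gamma>((\<tau>, n) := v))"
  by (auto simp: is_evaluation_def)

lemma is_evaluation_crossing:
  assumes "\<And>f. f \<in> F \<Longrightarrow> is_evaluation \<Sigma> (U f) (\<gamma> f)"
  shows "is_evaluation \<Sigma> (infra_prod F D U) (crossing F U \<gamma>)"
  using assms by (auto simp: is_evaluation_def crossing_def intro: cross_val_mem_realm)

text \<open>Constants of the infraproduct and crossed evaluations are built by the same
  \<open>cross_val\<close>, so both kinds of terms are treated at once.\<close>

lemma term_val_crossing:
  assumes "term_of_type \<Sigma> \<tau> t"
  shows "term_val (infra_prod F D U) (crossing F U \<gamma>) t =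
    cross_val F (\<lambda>f. support (U f)) \<tau> (\<lambda>f. term_val (U f) (\<gamma> f) t)"
  using assms by (cases t) (auto simp: crossing_def)

lemma term_val_upd:
  "t \<noteq> Var \<tau> n \<Longrightarrow> term_val U (\<gamma>((\<tau>, n) := v)) t = term_val U \<gamma> t"
  by (cases t) auto

lemma params_term_of_type:
  "is_formula \<Sigma> \<phi> \<Longrightarrow> t \<in> params \<phi> \<Longrightarrow> \<exists>\<tau>. term_of_type \<Sigma> \<tau> t"
  by (induction \<phi>) auto

lemma (in ultrafilter) sat_infra_prod:
  fixes \<Sigma> :: "'w signature" and U :: "'i \<Rightarrow> ('a, 'w) system"
  assumes sys: "\<And>f. f \<in> F \<Longrightarrow> is_system \<Sigma> (U f)"
    and nonempty: "\<And>f. f \<in> F \<Longrightarrow> support (U f) \<noteq> {}"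
    and "is_formula \<Sigma> \<phi>"
    and "is_evaluation \<Sigma> (infra_prod F D U) \<delta>"
    and "\<forall>t\<in>params \<phi>. almost (\<lambda>g. slice (term_val (infra_prod F D U) \<delta> t) g = term_val (U g) (\<gamma> g) t)"
  shows "sat (infra_prod F D U) \<delta> \<phi> \<longleftrightarrow> almost (\<lambda>g. sat (U g) (\<gamma> g) \<phi>)"
  using assms(3-)
proof (induction \<phi> arbitrary: \<delta> \<gamma>)
  case (Eq \<tau> q r)
  note mem = term_val_infra_prod_mem_realm[OF sys Eq.prems(2)]
  \<comment> \<open>Both sides have the right slices on a common set of \<open>D\<close>; there the
    two atomic statements coincide.\<close>
  have "almost (\<lambda>g. slice (term_val (infra_prod F D U) \<delta> q) g = term_val (U g) (\<gamma> g) q \<and>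
      slice (term_val (infra_prod F D U) \<delta> r) g = term_val (U g) (\<gamma> g) r)"
    using Eq.prems(3) by (simp add: almost_conj)
  then have "almost (\<lambda>g. (slice (term_val (infra_prod F D U) \<delta> q) g,
      slice (term_val (infra_prod F D U) \<delta> r) g) \<in> geq (U g) \<tau>) \<longleftrightarrow>
    almost (\<lambda>g. sat (U g) (\<gamma> g) (Eq \<tau> q r))"
    by (rule almost_cong) simp
  then show ?case
    using Eq.prems(1) mem by (simp add: geq_infra_prod)
next
  case (Bel k qs r)
  let ?val = "term_val (infra_prod F D U) \<delta>"
  let ?p = "map (\<lambda>q. the_elem (?val q)) qs"
  have q: "?val q \<in> realm Fst (\<Pi>\<^sub>E f\<in>F. support (U f))" if "q \<in> set qs" for q
    using that Bel.prems(1) by (intro term_val_infra_prod_mem_realm[OF sys Bel.prems(2)]) auto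
  have r: "?val r \<in> realm (Snd k) (\<Pi>\<^sub>E f\<in>F. support (U f))"
    using Bel.prems(1) by (intro term_val_infra_prod_mem_realm[OF sys Bel.prems(2)]) auto
  have p: "?p \<in> nlists (Suc k) (\<Pi>\<^sub>E f\<in>F. support (U f))"
  proof (rule nlistsI)
    show "set ?p \<subseteq> (\<Pi>\<^sub>E f\<in>F. support (U f))"
    proof
      fix x
      assume "x \<in> set ?p"
      then obtain t where t: "t \<in> set qs" "x = the_elem (?val t)" by auto
      with q[OF t(1)] show "x \<in> (\<Pi>\<^sub>E f\<in>F. support (U f))"
        by (auto simp only: realm.simps so_val.sel)
    qed
  qed (use Bel.prems(1) in simp)
  \<comment> \<open>There are finitely many terms, so a single set of \<open>D\<close> serves all of
    them.\<close>
  have "almost (\<lambda>g. \<forall>t\<in>insert r (set qs). slice (?val t) g = term_val (U g) (\<gamma> g) t)"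
    using Bel.prems(3) by (intro almost_ball_finite) auto
  then have "almost (\<lambda>g. (tuple_at ?p g, slice (?val r) g) \<in> gbel (U g) k) \<longleftrightarrow>
    almost (\<lambda>g. sat (U g) (\<gamma> g) (Bel k qs r))"
  proof (rule almost_cong)
    fix g
    assume "g \<in> F" and eq: "\<forall>t\<in>insert r (set qs). slice (?val t) g = term_val (U g) (\<gamma> g) t"
    have "the_elem (?val t) g = the_elem (term_val (U g) (\<gamma> g) t)" if t: "t \<in> set qs" for t
    proof -
      obtain x where "?val t = Elem x" using q[OF t] by auto
      moreover have "slice (?val t) g = term_val (U g) (\<gamma> g) t" using eq t by simp
      \<comment> \<open>\<open>q\<close> makes the value an \<open>Elem\<close>, so
        \<open>the_elem\<close> commutes with slicing.\<close>
      ultimately show ?thesis by (metis slice.simps(1) so_val.sel(1))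
    qed
    then have "tuple_at ?p g = map (\<lambda>q. the_elem (term_val (U g) (\<gamma> g) q)) qs"
      by (simp add: tuple_at_def)
    then show "(tuple_at ?p g, slice (?val r) g) \<in> gbel (U g) k \<longleftrightarrow> sat (U g) (\<gamma> g) (Bel k qs r)"
      using eq by simp
  qed
  then show ?case
    using p r by (simp add: gbel_infra_prod del: realm.simps)
next
  case (Neg \<phi>)
  then show ?case by (simp add: almost_not)
next
  case (Conj \<phi> \<psi>)
  from Conj.prems Conj.IH[of \<delta> \<gamma>] show ?case by (simp add: almost_conj)
next
  case (Disj \<phi> \<psi>)
  from Disj.prems Disj.IH[of \<delta> \<gamma>] show ?case by (simp add: almost_disj)
next
  case (Imp \<phi> \<psi>)
  from Imp.prems Imp.IH[of \<delta> \<gamma>] show ?case by (simp add: almost_imp)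
next
  case (Ex \<tau> n \<phi>)
  \<comment> \<open>The factors give the bound variable the slices of \<open>v\<close>, so agreement
    there holds by construction; the other parameters are unaffected by the update.\<close>
  have "sat (infra_prod F D U) (\<delta>((\<tau>, n) := v)) \<phi> \<longleftrightarrow>
      almost (\<lambda>g. sat (U g) ((\<gamma> g)((\<tau>, n) := slice v g)) \<phi>)"
    if "v \<in> realm \<tau> (\<Pi>\<^sub>E f\<in>F. support (U f))" for v
  proof (rule Ex.IH)
    show "\<forall>t\<in>params \<phi>. almost (\<lambda>g. slice (term_val (infra_prod F D U) (\<delta>((\<tau>, n) := v)) t) g =
        term_val (U g) ((\<gamma> g)((\<tau>, n) := slice v g)) t)"
    proof
      fix t
      assume "t \<in> params \<phi>"
      then show "almost (\<lambda>g. slice (term_val (infra_prod F D U) (\<delta>((\<tau>, n) := v)) t) g =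
          term_val (U g) ((\<gamma> g)((\<tau>, n) := slice v g)) t)"
        using Ex.prems(3) by (cases "t = Var \<tau> n") (auto simp: term_val_upd intro: almostI)
    qed
  qed (use Ex.prems that in \<open>simp_all add: is_evaluation_upd del: fun_upd_apply\<close>)
  then show ?case
    using almost_bex_realm[of "\<lambda>f. support (U f)" \<tau> "\<lambda>g x. sat (U g) ((\<gamma> g)((\<tau>, n) := x)) \<phi>"] nonempty
    by simp
next
  case (All \<tau> n \<phi>)
  have "sat (infra_prod F D U) (\<delta>((\<tau>, n) := v)) \<phi> \<longleftrightarrow>
      almost (\<lambda>g. sat (U g) ((\<gamma> g)((\<tau>, n) := slice v g)) \<phi>)"
    if "v \<in> realm \<tau> (\<Pi>\<^sub>E f\<in>F. support (U f))" for v
  proof (rule All.IH)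
    show "\<forall>t\<in>params \<phi>. almost (\<lambda>g. slice (term_val (infra_prod F D U) (\<delta>((\<tau>, n) := v)) t) g =
        term_val (U g) ((\<gamma> g)((\<tau>, n) := slice v g)) t)"
    proof
      fix t
      assume "t \<in> params \<phi>"
      then show "almost (\<lambda>g. slice (term_val (infra_prod F D U) (\<delta>((\<tau>, n) := v)) t) g =
          term_val (U g) ((\<gamma> g)((\<tau>, n) := slice v g)) t)"
        using All.prems(3) by (cases "t = Var \<tau> n") (auto simp: term_val_upd intro: almostI)
    qed
  qed (use All.prems that in \<open>simp_all add: is_evaluation_upd del: fun_upd_apply\<close>)
  then show ?case
    using almost_ball_realm[of "\<lambda>f. support (U f)" \<tau> "\<lambda>g x. sat (U g) ((\<gamma> g)((\<tau>, n) := x)) \<phi>"] nonempty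
    by simp
qed

theorem theorem2:
  fixes \<Sigma> :: "'w signature" and F :: "'i set" and D :: "'i set set" and \<phi> :: "'w so_form"
    and U :: "'i \<Rightarrow> ('a, 'w) system" and \<gamma> :: "'i \<Rightarrow> 'a evaluation"
  assumes "is_signature \<Sigma>"
    and "ultrafilter_on F D"
    and "is_formula \<Sigma> \<phi>"
    and "\<And>f. f \<in> F \<Longrightarrow> is_system \<Sigma> (U f)"
    and "\<And>f. f \<in> F \<Longrightarrow> true_geq_gbel \<Sigma> (U f)"
    and "\<And>f. f \<in> F \<Longrightarrow> is_evaluation \<Sigma> (U f) (\<gamma> f)"
    and "no_sporadic_empty F D U \<gamma> \<phi>"
  shows "sat (infra_prod F D U) (crossing F U \<gamma>) \<phi> \<longleftrightarrow> {g \<in> F. sat (U g) (\<gamma> g) \<phi>} \<in> D"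
proof -
  interpret ultrafilter F D
    by unfold_locales (rule assms(2))
  \<comment> \<open>The value of a first-order variable is an element of the support.\<close>
  have "support (U f) \<noteq> {}" if "f \<in> F" for f
  proof -
    have "\<gamma> f (Fst, 0) \<in> realm Fst (support (U f))"
      using assms(1) assms(6)[OF that] by (simp add: is_signature_def is_evaluation_def del: realm.simps)
    then show ?thesis by auto
  qed
  moreover have "almost (\<lambda>g. slice (term_val (infra_prod F D U) (crossing F U \<gamma>) t) g =
      term_val (U g) (\<gamma> g) t)" if t: "t \<in> params \<phi>" for t
  proof -
    obtain \<tau> where \<tau>: "term_of_type \<Sigma> \<tau> t"
      using params_term_of_type[OF assms(3) t] by blast
    \<comment> \<open>\<open>no_sporadic_empty\<close> is the hypothesis of
      \<open>almost_slice_cross_val\<close> for each parameter, so the crossing agrees with the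
      \<open>\<gamma> f\<close> as the induction requires.\<close>
    have "let E = {f \<in> F. term_val (U f) (\<gamma> f) t = Rel {}} in E = {} \<or> E \<in> D"
      using assms(7) t by (simp add: no_sporadic_empty_def)
    then show ?thesis
      unfolding term_val_crossing[OF \<tau>]
      by (intro almost_slice_cross_val term_val_mem_realm[OF assms(4,6) \<tau>])
  qed
  ultimately show ?thesis
    using sat_infra_prod[OF assms(4) _ assms(3) is_evaluation_crossing[OF assms(6)]]
    by (simp add: almost_def)
qed

end
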